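(* Let $p$ be an odd prime, let $m$ be an integer with $m\not\equiv 0\pmod{p}$, and let $\Delta=m(m-4)$. For any positive integer $n$, \[ \frac{1}{pn}\bigg(\sum_{k=0}^{pn-1}\binom{pn-1}{k}\frac{\binom{2k}{k}}{(-m)^k}-\Big(\frac{\Delta}{p}\Big)\sum_{k=0}^{n-1}\binom{n-1}{k}\frac{\binom{2k}{k}}{(-m)^k}\bigg)\in\mathbb{Z}_p . \]
   Context: $\big(\frac{\cdot}{p}\big)$ denotes the Legendre symbol (so $\big(\frac{\Delta}{p}\big)=0$ if $p\mid\Delta$), and $\mathbb{Z}_p$ is the ring of $p$-adic integers. *)

theory Defs
  imports Complex_Main "HOL-Number_Theory.Number_Theory"
begin

definition padic_val :: "nat \<Rightarrow> rat \<Rightarrow> int" where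
  "padic_val p x =
     int (multiplicity (int p) (fst (quotient_of x)))
   - int (multiplicity (int p) (snd (quotient_of x)))"

definition padic_norm :: "nat \<Rightarrow> rat \<Rightarrow> rat" where
  "padic_norm p x = (if x = 0 then 0 else of_nat p powi (- padic_val p x))"

text \<open>The ring of \<open>p\<close>-adic integers is the closed unit ball of the completion of the
  rationals with respect to \<open>padic_norm p\<close>. Only rational elements are needed here, and the
  norm of the completion extends \<open>padic_norm p\<close>; so the following set consists of exactly
  the rationals that lie in that ring.\<close>

definition rat_padic_ints :: "nat \<Rightarrow> rat set" where
  "rat_padic_ints p = {x. padic_norm p x \<le> 1}"

end

theory Submission
  imports Defs "HOL-Computational_Algebra.Formal_Laurent_Series"
begin

text \<open>Put \<open>a = 2 - m\<close> and \<open>f = 1 - a X + X\<^sup>2 = m X + (1 - X)\<^sup>2\<close>. Expanding the latter form, the sum up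
  to \<open>n - 1\<close> is \<open>m\<^sup>1\<^sup>-\<^sup>n\<close> times the central coefficient of \<open>f\<^sup>n\<^sup>-\<^sup>1\<close>. Since \<open>1 / f\<close> generates the
  Lucas sequence \<open>u\<close> of discriminant \<open>a\<^sup>2 - 4 = \<Delta>\<close>, that coefficient is the sum over \<open>i < n\<close> of
  \<open>c\<^sub>i u(n - i)\<close> with \<open>c\<^sub>i\<close> the coefficients of \<open>f\<^sup>n\<close>. Let \<open>p\<^sup>w\<close> be the exact power of \<open>p\<close> in \<open>n\<close>.
  Modulo \<open>p\<^sup>w\<^sup>+\<^sup>1\<close> the series \<open>f(X)\<^sup>p\<^sup>n\<close> agrees with \<open>f(X\<^sup>p)\<^sup>n\<close>, so the coefficient for \<open>p n\<close> is the sum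
  of \<open>c\<^sub>i u(p (n - i))\<close>. Finally \<open>u(p j)\<close> agrees with the Legendre symbol times \<open>u(j)\<close> modulo
  \<open>p\<close> times the \<open>p\<close>-part of \<open>j\<close>, and \<open>n\<close> divides \<open>(n - i) c\<^sub>i\<close> (differentiate \<open>f\<^sup>n\<close>), so each
  term changes only by a multiple of \<open>p\<^sup>w\<^sup>+\<^sup>1\<close>.\<close>

section \<open>Congruences between powers modulo \<open>p\<close> and powers of
  \<open>p\<close>\<close>

lemma prime_dvd_power_add_diff:
  fixes x y :: "'a :: comm_ring_1"
  assumes "prime p"
  shows "of_nat p dvd (x + y) ^ p - (x ^ p + y ^ p)"
proof -
  have p: "p > 0" using assms prime_gt_0_nat by blast
  have split: "{..p} = insert 0 (insert p {1..<p})" using p by auto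
  have "(x + y) ^ p = x ^ p + y ^ p + (\<Sum>k\<in>{1..<p}. of_nat (p choose k) * x ^ k * y ^ (p - k))"
    using p unfolding binomial_ring split by (subst sum.insert; simp add: algebra_simps)+
  moreover have "of_nat p dvd (\<Sum>k\<in>{1..<p}. of_nat (p choose k) * x ^ k * y ^ (p - k))"
  proof (rule dvd_sum)
    fix k assume "k \<in> {1..<p}"
    hence "p dvd p choose k" using assms by (intro dvd_choose_prime) auto
    then obtain q where "p choose k = p * q" by (elim dvdE)
    thus "of_nat p dvd of_nat (p choose k) * x ^ k * y ^ (p - k)"
      by (simp add: mult.assoc)
  qed
  ultimately show ?thesis by simp
qed

text \<open>Factor \<open>x ^ p - y ^ p\<close> as \<open>x - y\<close> times a sum of
  \<open>p\<close> terms. Modulo \<open>p\<close> all of these equal \<open>y ^ (p - 1)\<close>, so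
  the sum contributes one more factor \<open>p\<close>. The ring is general because integers and
  power series both occur.\<close>

lemma dvd_power_diff_lift:
  fixes x y :: "'a :: comm_ring_1"
  assumes "of_nat p ^ Suc k dvd x - y"
  shows "of_nat p ^ Suc (Suc k) dvd x ^ p - y ^ p"
proof -
  have xy: "of_nat p dvd x - y" using assms by (rule dvd_trans[rotated]) simp
  have "of_nat p dvd (\<Sum>i<p. y ^ (p - Suc i) * x ^ i) - (\<Sum>i<p. y ^ (p - Suc i) * y ^ i)"
    unfolding sum_subtractf[symmetric] right_diff_distrib[symmetric]
  proof (intro dvd_sum dvd_mult)
    fix i show "of_nat p dvd x ^ i - y ^ i"
      using xy by (subst power_diff_sumr2) (rule dvd_mult2)
  qed
  moreover have "(\<Sum>i<p. y ^ (p - Suc i) * y ^ i) = of_nat p * y ^ (p - 1)"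
    by (simp add: power_add[symmetric])
  ultimately have "of_nat p dvd (\<Sum>i<p. y ^ (p - Suc i) * x ^ i)"
    by (metis diff_add_cancel dvd_add dvd_triv_left)
  with assms show ?thesis
    by (subst power_diff_sumr2, subst power_Suc2) (rule mult_dvd_mono)
qed

text \<open>The lift is iterated \<open>w\<close> times to reach the exponent \<open>p ^ w\<close>;
  the cofactor \<open>l\<close> of \<open>n\<close> costs nothing, since \<open>x - y\<close>
  divides \<open>x ^ l - y ^ l\<close>.\<close>

lemma dvd_power_mult_diff:
  fixes x y :: "'a :: comm_ring_1"
  assumes "of_nat p dvd x - y" and "p ^ w dvd n"
  shows "of_nat p ^ Suc w dvd x ^ n - y ^ n"
proof -
  obtain l where n: "n = p ^ w * l" using assms(2) by (elim dvdE)
  have "of_nat p ^ Suc w dvd x ^ (p ^ w) - y ^ (p ^ w)"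
  proof (induction w)
    case (Suc w)
    from dvd_power_diff_lift[OF Suc] show ?case by (simp add: power_mult[symmetric] mult_ac)
  qed (use assms(1) in simp)
  thus ?thesis unfolding n power_mult by (subst power_diff_sumr2) (rule dvd_mult2)
qed

text \<open>This form of Fermat's theorem also covers multiples of \<open>p\<close>, so it applies
  to Lucas numbers and to \<open>a\<close> without case distinctions.\<close>

lemma cong_power_prime_int:
  fixes a :: int
  assumes "prime p"
  shows "[a ^ p = a] (mod int p)"
proof (cases "int p dvd a")
  case True
  hence "int p dvd a ^ p" using assms by (simp add: dvd_power_le prime_gt_0_nat dvd_trans dvd_power)
  with True show ?thesis by (simp add: cong_iff_dvd_diff)
next
  case False
  define b where "b = nat (a mod int p)"
  have p: "p > 0" using assms prime_gt_0_nat by blast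
  have b: "[a = int b] (mod int p)" using p by (simp add: b_def cong_def)
  hence "\<not> p dvd b" using False by (metis cong_dvd_iff int_dvd_int_iff cong_sym)
  hence "[b ^ (p - 1) = 1] (mod p)" using assms by (rule fermat_theorem[rotated])
  hence "[b ^ (p - 1) * b = 1 * b] (mod p)" by (intro cong_mult cong_refl)
  hence "[b ^ p = b] (mod p)" using p by (metis Suc_diff_1 mult_1 power_Suc2)
  hence "[int b ^ p = int b] (mod int p)" by (metis cong_int_iff of_nat_power)
  thus ?thesis using b by (meson cong_pow cong_sym cong_trans)
qed

lemma fermat_theorem_int:
  fixes a :: int
  assumes "prime p" and "\<not> int p dvd a"
  shows "[a ^ (p - 1) = 1] (mod int p)"
proof -
  have "coprime a (int p)"
    using assms prime_imp_coprime[of "int p" a] by (simp add: coprime_commute)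
  moreover have "[a * a ^ (p - 1) = a * 1] (mod int p)"
    using cong_power_prime_int[OF assms(1)] prime_gt_0_nat[OF assms(1)]
    by (metis Suc_diff_1 mult.right_neutral power_Suc)
  ultimately show ?thesis by (simp only: cong_mult_lcancel)
qed

section \<open>Lucas sequences and their congruences at multiples of \<open>p\<close>\<close>

fun lucas_u :: "int \<Rightarrow> nat \<Rightarrow> int" where
  "lucas_u a 0 = 0"
| "lucas_u a (Suc 0) = 1"
| "lucas_u a (Suc (Suc n)) = a * lucas_u a (Suc n) - lucas_u a n"

text \<open>The companion sequence: the sum of the \<open>n\<close>-th powers of the roots of
  \<open>x^2 - a x + 1\<close>. With \<open>D = a ^ 2 - 4\<close>, those powers are
  \<open>(v + u sqrt D) / 2\<close> and \<open>(v - u sqrt D) / 2\<close>.\<close>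

definition lucas_v :: "int \<Rightarrow> nat \<Rightarrow> int" where
  "lucas_v a n = 2 * lucas_u a (Suc n) - a * lucas_u a n"

lemma lucas_u_Suc: "2 * lucas_u a (Suc n) = a * lucas_u a n + lucas_v a n"
  by (simp add: lucas_v_def)

lemma lucas_v_Suc: "2 * lucas_v a (Suc n) = a * lucas_v a n + (a ^ 2 - 4) * lucas_u a n"
  by (simp add: lucas_v_def algebra_simps power2_eq_square)

lemma lucas_v_0 [simp]: "lucas_v a 0 = 2"
  by (simp add: lucas_v_def)

text \<open>Multiply the \<open>m\<close>-th and \<open>n\<close>-th powers of a root
  \<open>(a + sqrt D) / 2\<close> and compare coordinates. Each induction step uses both identities,
  hence the joint induction.\<close>

lemma lucas_add:
  "2 * lucas_u a (m + n) = lucas_u a m * lucas_v a n + lucas_v a m * lucas_u a n"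
  "2 * lucas_v a (m + n) = lucas_v a m * lucas_v a n + (a ^ 2 - 4) * lucas_u a m * lucas_u a n"
proof (induction n)
  case (Suc n)
  let ?u = "lucas_u a" and ?v = "lucas_v a"
  {
    case 1
    \<comment> \<open>The second factor 2 lets the doubled recurrences apply at \<open>m + n\<close>
      and at \<open>n\<close> without halving.\<close>
    have "2 * (2 * ?u (m + Suc n)) = a * (2 * ?u (m + n)) + 2 * ?v (m + n)"
      using lucas_u_Suc[of a "m + n"] by simp
    also have "\<dots> = ?u m * (a * ?v n + (a ^ 2 - 4) * ?u n) + ?v m * (a * ?u n + ?v n)"
      unfolding Suc by (simp add: algebra_simps)
    also have "\<dots> = 2 * (?u m * ?v (Suc n) + ?v m * ?u (Suc n))"
      unfolding lucas_v_Suc[symmetric] lucas_u_Suc[symmetric] by (simp add: algebra_simps)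
    finally show ?case by simp
  next
    case 2
    have "2 * (2 * ?v (m + Suc n)) = a * (2 * ?v (m + n)) + (a ^ 2 - 4) * (2 * ?u (m + n))"
      using lucas_v_Suc[of a "m + n"] by simp
    also have "\<dots> = ?v m * (a * ?v n + (a ^ 2 - 4) * ?u n) + (a ^ 2 - 4) * ?u m * (a * ?u n + ?v n)"
      unfolding Suc by (simp add: algebra_simps)
    also have "\<dots> = 2 * (?v m * ?v (Suc n) + (a ^ 2 - 4) * ?u m * ?u (Suc n))"
      unfolding lucas_v_Suc[symmetric] lucas_u_Suc[symmetric] by (simp add: algebra_simps)
    finally show ?case by simp
  }
qed simp_all

text \<open>The two roots have product 1, and so do their \<open>n\<close>-th powers. The identity
  later turns a congruence for \<open>v\<close> into one for \<open>D * u ^ 2\<close>.\<close>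

lemma lucas_norm: "lucas_v a n ^ 2 - (a ^ 2 - 4) * lucas_u a n ^ 2 = 4"
proof (induction n)
  case (Suc n)
  let ?u = "lucas_u a" and ?v = "lucas_v a"
  have "4 * (?v (Suc n) ^ 2 - (a ^ 2 - 4) * ?u (Suc n) ^ 2)
      = (2 * ?v (Suc n)) ^ 2 - (a ^ 2 - 4) * (2 * ?u (Suc n)) ^ 2"
    by (simp add: power_mult_distrib)
  also have "\<dots> = 4 * (?v n ^ 2 - (a ^ 2 - 4) * ?u n ^ 2)"
    unfolding lucas_u_Suc lucas_v_Suc by (simp add: algebra_simps power2_eq_square)
  finally show ?case using Suc by simp
qed simp

text \<open>Both identities compare the coordinates, with respect to \<open>1\<close> and \<open>sqrt D\<close>, of the \<open>(k + 1)\<close>-st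
  power of \<open>v + u sqrt D\<close>.\<close>

lemma lucas_times:
  fixes a :: int and j :: nat
  defines "u \<equiv> lucas_u a j" and "v \<equiv> lucas_v a j" and "D \<equiv> a ^ 2 - 4"
  shows "2 ^ k * lucas_u a (Suc k * j)
       = (\<Sum>i\<le>Suc k. of_nat (Suc k choose (2 * i + 1)) * v ^ (Suc k - (2 * i + 1)) * u ^ (2 * i + 1) * D ^ i)"
    and "2 ^ k * lucas_v a (Suc k * j)
       = (\<Sum>i\<le>Suc k. of_nat (Suc k choose (2 * i)) * v ^ (Suc k - 2 * i) * u ^ (2 * i) * D ^ i)"
proof -
  define c where "c k i = int (k choose i) * v ^ (k - i) * u ^ i" for k i
  \<comment> \<open>Here \<open>(v + u sqrt D) ^ k\<close> is \<open>G k + F k * sqrt D\<close>.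
    Terms beyond the binomial row vanish, so the limit can be raised by one to match the range at
    \<open>Suc k\<close>.\<close>
  define F where "F k = (\<Sum>i\<le>k. c k (2 * i + 1) * D ^ i)" for k
  define G where "G k = (\<Sum>i\<le>k. c k (2 * i) * D ^ i)" for k
  have c_zero: "c k i = 0" if "k < i" for k i
    using that by (simp add: c_def)
  have c_Suc: "c (Suc k) (Suc i) = v * c k (Suc i) + u * c k i" for k i
  proof (cases "Suc i \<le> k")
    case True
    hence "k - i = Suc (k - Suc i)" by simp
    thus ?thesis by (simp add: c_def algebra_simps)
  next
    case False
    hence "i = k \<or> k < i" by linarith
    thus ?thesis by (auto simp: c_def binomial_eq_0)
  qed
  have F_ext: "F k = (\<Sum>i\<le>Suc k. c k (2 * i + 1) * D ^ i)" for k
    by (simp add: F_def c_zero)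
  have G_ext: "G k = (\<Sum>i\<le>Suc k. c k (2 * i) * D ^ i)" for k
    by (simp add: G_def c_zero)
  have F_Suc: "F (Suc k) = v * F k + u * G k" for k
    unfolding F_ext[of k] G_ext[of k] unfolding F_def
    by (simp only: c_Suc Suc_eq_plus1[symmetric] sum_distrib_left sum.distrib[symmetric])
       (simp only: algebra_simps)
  have G_Suc: "G (Suc k) = v * G k + D * u * F k" for k
  proof -
    have "G (Suc k) = c (Suc k) 0 + (\<Sum>i\<le>k. c (Suc k) (Suc (Suc (2 * i))) * D ^ Suc i)"
      unfolding G_def by (subst sum.atMost_Suc_shift) simp
    also have "\<dots> = v * (c k 0 + (\<Sum>i\<le>k. c k (Suc (Suc (2 * i))) * D ^ Suc i)) + D * u * F k"
      unfolding F_def by (simp add: c_Suc sum_distrib_left sum.distrib[symmetric] algebra_simps)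
        (simp add: c_def)
    also have "c k 0 + (\<Sum>i\<le>k. c k (Suc (Suc (2 * i))) * D ^ Suc i) = G k"
      unfolding G_ext by (subst sum.atMost_Suc_shift) simp
    finally show ?thesis .
  qed
  have "2 ^ k * lucas_u a (Suc k * j) = F (Suc k) \<and> 2 ^ k * lucas_v a (Suc k * j) = G (Suc k)"
  proof (induction k)
    case 0
    show ?case by (simp add: F_def G_def c_def u_def v_def)
  next
    case (Suc k)
    have "2 ^ Suc k * lucas_u a (Suc (Suc k) * j) = 2 ^ k * (2 * lucas_u a (j + Suc k * j))"
      by simp
    also have "\<dots> = u * (2 ^ k * lucas_v a (Suc k * j)) + v * (2 ^ k * lucas_u a (Suc k * j))"
      unfolding lucas_add u_def v_def by (simp add: algebra_simps)
    also have "\<dots> = F (Suc (Suc k))"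
      using Suc by (simp add: F_Suc[of "Suc k"])
    finally have 1: "2 ^ Suc k * lucas_u a (Suc (Suc k) * j) = F (Suc (Suc k))" .
    have "2 ^ Suc k * lucas_v a (Suc (Suc k) * j) = 2 ^ k * (2 * lucas_v a (j + Suc k * j))"
      by simp
    also have "\<dots> = v * (2 ^ k * lucas_v a (Suc k * j)) + D * u * (2 ^ k * lucas_u a (Suc k * j))"
      unfolding lucas_add u_def v_def D_def by (simp add: algebra_simps)
    also have "\<dots> = G (Suc (Suc k))"
      using Suc by (simp add: G_Suc[of "Suc k"])
    finally show ?case using 1 by simp
  qed
  thus "2 ^ k * lucas_u a (Suc k * j)
       = (\<Sum>i\<le>Suc k. of_nat (Suc k choose (2 * i + 1)) * v ^ (Suc k - (2 * i + 1)) * u ^ (2 * i + 1) * D ^ i)"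
    and "2 ^ k * lucas_v a (Suc k * j)
       = (\<Sum>i\<le>Suc k. of_nat (Suc k choose (2 * i)) * v ^ (Suc k - 2 * i) * u ^ (2 * i) * D ^ i)"
    unfolding F_def G_def c_def by simp_all
qed

lemma cong_mult_left_dvd:
  fixes x y p q c :: int
  assumes "p dvd c" and "[x = y] (mod q)"
  shows "[c * x = c * y] (mod p * q)"
  using assms by (simp add: cong_iff_dvd_diff mult_dvd_mono right_diff_distrib[symmetric])

lemma cong_power_lift_int:
  fixes x y :: int
  assumes "[x = y] (mod int p ^ Suc k)"
  shows "[x ^ p = y ^ p] (mod int p ^ Suc (Suc k))"
  using dvd_power_diff_lift[of p k x y] assms by (simp add: cong_iff_dvd_diff)

text \<open>The hypothesis on \<open>D\<close> covers \<open>\<epsilon> = 0\<close>, where \<open>u'\<close> and \<open>u\<close> need not have congruent squares.\<close>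

lemma lucas_sum_lift:
  fixes u v u' v' \<epsilon> D :: int
  assumes p: "prime p" "odd p" and eps: "\<epsilon> \<in> {-1, 0, 1}"
    and u: "[u' = \<epsilon> * u] (mod int p ^ Suc k)" and v: "[v' = v] (mod int p ^ Suc k)"
    and D: "[D * u' ^ 2 = D * u ^ 2] (mod int p ^ Suc k)"
  shows "[(\<Sum>i\<le>p. of_nat (p choose (2 * i + 1)) * v' ^ (p - (2 * i + 1)) * u' ^ (2 * i + 1) * D ^ i)
    = \<epsilon> * (\<Sum>i\<le>p. of_nat (p choose (2 * i + 1)) * v ^ (p - (2 * i + 1)) * u ^ (2 * i + 1) * D ^ i)]
    (mod int p ^ Suc (Suc k))" (is ?th1)
    and "[(\<Sum>i\<le>p. of_nat (p choose (2 * i)) * v' ^ (p - 2 * i) * u' ^ (2 * i) * D ^ i)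
    = (\<Sum>i\<le>p. of_nat (p choose (2 * i)) * v ^ (p - 2 * i) * u ^ (2 * i) * D ^ i)]
    (mod int p ^ Suc (Suc k))" (is ?th2)
proof -
  have eps_odd: "\<epsilon> ^ n = \<epsilon>" if "odd n" for n
    using eps that by (auto simp: odd_pos)
  have p_dvd: "int p dvd int (p choose i)" if "0 < i" "i < p" for i
    using that p by (intro dvd_choose_prime iffD2[OF int_dvd_int_iff]) auto
  show ?th1
    unfolding sum_distrib_left
  proof (rule cong_sum)
    fix i
    let ?n = "2 * i + 1 :: nat"
    have *: "[u' ^ ?n = \<epsilon> * u ^ ?n] (mod int p ^ Suc k)"
    proof -
      have "\<epsilon> ^ ?n = \<epsilon>" by (rule eps_odd) simp
      thus ?thesis using cong_pow[OF u, of ?n] by (simp only: power_mult_distrib)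
    qed
    \<comment> \<open>For \<open>?n < p\<close> the binomial coefficient supplies the extra factor
      \<open>p\<close>. For \<open>?n = p\<close> it is 1, and the gain comes from taking the
      \<open>p\<close>-th power of \<open>u'\<close>.\<close>
    consider "?n < p" | "?n = p" | "p < ?n" by linarith
    thus "[of_nat (p choose ?n) * v' ^ (p - ?n) * u' ^ ?n * D ^ i
      = \<epsilon> * (of_nat (p choose ?n) * v ^ (p - ?n) * u ^ ?n * D ^ i)] (mod int p ^ Suc (Suc k))"
    proof cases
      case 1
      have "[v' ^ (p - ?n) * u' ^ ?n * D ^ i = v ^ (p - ?n) * (\<epsilon> * u ^ ?n) * D ^ i] (mod int p ^ Suc k)"
        by (intro cong_mult cong_refl * cong_pow v)
      from cong_mult_left_dvd[OF p_dvd this, of ?n] 1 show ?thesis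
        by (simp add: mult_ac)
    next
      case 2
      have "[u' ^ p = \<epsilon> * u ^ p] (mod int p ^ Suc (Suc k))"
        using cong_power_lift_int[OF u] eps_odd[OF p(2)] by (simp add: power_mult_distrib)
      hence "[u' ^ p * D ^ i = \<epsilon> * u ^ p * D ^ i] (mod int p ^ Suc (Suc k))"
        by (intro cong_mult cong_refl)
      thus ?thesis unfolding 2 by (simp add: mult.assoc)
    qed (simp add: binomial_eq_0)
  qed
  show ?th2
  proof (rule cong_sum)
    fix i
    \<comment> \<open>Even powers of \<open>u'\<close> enter only through powers of
      \<open>D * u' ^ 2\<close>, so no square of \<epsilon> appears.\<close>
    have *: "[u' ^ (2 * i) * D ^ i = u ^ (2 * i) * D ^ i] (mod int p ^ Suc k)"
      using cong_pow[OF D, of i] 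
      by (simp only: power_mult_distrib power_mult[symmetric] mult.commute)
    have "2 * i \<noteq> p" using p(2) by auto
    then consider "i = 0" | "0 < 2 * i" "2 * i < p" | "p < 2 * i" by linarith
    thus "[of_nat (p choose (2 * i)) * v' ^ (p - 2 * i) * u' ^ (2 * i) * D ^ i
      = of_nat (p choose (2 * i)) * v ^ (p - 2 * i) * u ^ (2 * i) * D ^ i] (mod int p ^ Suc (Suc k))"
    proof cases
      case 1
      thus ?thesis using cong_power_lift_int[OF v] by simp
    next
      case 2
      have "[v' ^ (p - 2 * i) * (u' ^ (2 * i) * D ^ i) = v ^ (p - 2 * i) * (u ^ (2 * i) * D ^ i)]
        (mod int p ^ Suc k)"
        by (intro cong_mult * cong_pow v)
      from cong_mult_left_dvd[OF p_dvd[OF 2] this] show ?thesis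
        by (simp add: mult.assoc)
    qed (simp add: binomial_eq_0)
  qed
qed

text \<open>Modulo \<open>p\<close> only the terms with binomial coefficient 1 survive:
  \<open>u ^ p * D ^ ((p - 1) div 2)\<close> in the odd sum, evaluated by Fermat and Euler's
  criterion, and \<open>v ^ p\<close> in the even sum.\<close>

lemma lucas_sum_cong:
  fixes u v D :: int
  assumes p: "prime p" "odd p"
  shows "[(\<Sum>i\<le>p. of_nat (p choose (2 * i + 1)) * v ^ (p - (2 * i + 1)) * u ^ (2 * i + 1) * D ^ i)
    = Legendre D (int p) * u] (mod int p)" (is ?th1)
    and "[(\<Sum>i\<le>p. of_nat (p choose (2 * i)) * v ^ (p - 2 * i) * u ^ (2 * i) * D ^ i) = v] (mod int p)"
    (is ?th2)
proof -
  have p_dvd: "int p dvd int (p choose i)" if "i \<noteq> 0" "i \<noteq> p" for i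
  proof (cases "i < p")
    case True
    thus ?thesis using that p by (intro dvd_choose_prime iffD2[OF int_dvd_int_iff]) auto
  qed (use that in \<open>simp add: binomial_eq_0\<close>)
  have p2: "2 < p" using p prime_ge_2_nat[of p] by (cases "p = 2") auto
  have "[(\<Sum>i\<le>p. of_nat (p choose (2 * i + 1)) * v ^ (p - (2 * i + 1)) * u ^ (2 * i + 1) * D ^ i)
    = (\<Sum>i\<le>p. if i = (p - 1) div 2 then u ^ p * D ^ i else 0)] (mod int p)"
  proof (rule cong_sum)
    fix i
    show "[of_nat (p choose (2 * i + 1)) * v ^ (p - (2 * i + 1)) * u ^ (2 * i + 1) * D ^ i
      = (if i = (p - 1) div 2 then u ^ p * D ^ i else 0)] (mod int p)"
    proof (cases "2 * i + 1 = p")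
      case True
      moreover from this have "i = (p - 1) div 2" by auto
      ultimately show ?thesis by simp
    next
      case False
      moreover from this have "i \<noteq> (p - 1) div 2" using p(2) by auto
      ultimately show ?thesis using p_dvd[of "2 * i + 1"]
        by (simp add: cong_0_iff)
    qed
  qed
  also have "(\<Sum>i\<le>p. if i = (p - 1) div 2 then u ^ p * D ^ i else 0) = u ^ p * D ^ ((p - 1) div 2)"
    by (subst sum.delta) auto
  also have "[u ^ p * D ^ ((p - 1) div 2) = u * Legendre D (int p)] (mod int p)"
    using euler_criterion[OF p(1) p2, of D]
    by (intro cong_mult cong_power_prime_int p) (rule cong_sym)
  finally show ?th1 by (simp add: mult.commute)
  have "[(\<Sum>i\<le>p. of_nat (p choose (2 * i)) * v ^ (p - 2 * i) * u ^ (2 * i) * D ^ i)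
    = (\<Sum>i\<le>p. if i = 0 then v ^ p else 0)] (mod int p)"
  proof (rule cong_sum)
    fix i
    have "2 * i \<noteq> p" using p(2) by auto
    thus "[of_nat (p choose (2 * i)) * v ^ (p - 2 * i) * u ^ (2 * i) * D ^ i
      = (if i = 0 then v ^ p else 0)] (mod int p)"
      using p_dvd[of "2 * i"] by (simp add: cong_0_iff)
  qed
  also have "(\<Sum>i\<le>p. if i = 0 then v ^ p else 0) = v ^ p"
    by (subst sum.delta) auto
  also have "[v ^ p = v] (mod int p)" by (rule cong_power_prime_int[OF p(1)])
  finally show ?th2 .
qed

lemma Legendre_cases: "Legendre a q \<in> {-1, 0, 1}"
  by (simp add: Legendre_def)

text \<open>Induction on \<open>w\<close>: \<open>lucas_sum_cong\<close> is the base, and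
  \<open>lucas_sum_lift\<close> compares the expansions at \<open>p * (p * j)\<close> and
  \<open>p * j\<close>. The claim for \<open>lucas_v\<close> is carried along because each expansion
  involves both sequences.\<close>

lemma lucas_cong_prime_power:
  fixes a :: int
  assumes p: "prime p" "odd p"
  defines "\<epsilon> \<equiv> Legendre (a ^ 2 - 4) (int p)"
  shows "[lucas_u a (p * (p ^ w * l)) = \<epsilon> * lucas_u a (p ^ w * l)] (mod int p ^ Suc w)
    \<and> [lucas_v a (p * (p ^ w * l)) = lucas_v a (p ^ w * l)] (mod int p ^ Suc w)"
proof -
  let ?D = "a ^ 2 - 4"
  define F where "F u v = (\<Sum>i\<le>p. of_nat (p choose (2 * i + 1)) * v ^ (p - (2 * i + 1))
    * u ^ (2 * i + 1) * ?D ^ i)" for u v :: int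
  define G where "G u v = (\<Sum>i\<le>p. of_nat (p choose (2 * i)) * v ^ (p - 2 * i)
    * u ^ (2 * i) * ?D ^ i)" for u v :: int
  have FG: "2 ^ (p - 1) * lucas_u a (p * j) = F (lucas_u a j) (lucas_v a j)"
      "2 ^ (p - 1) * lucas_v a (p * j) = G (lucas_u a j) (lucas_v a j)" for j
    using lucas_times[of "p - 1" a j] prime_gt_0_nat[OF p(1)] by (simp_all add: F_def G_def)
  have two: "\<not> int p dvd 2"
    using p by (metis int_dvd_int_iff of_nat_numeral primes_dvd_imp_eq two_is_prime_nat dvd_refl)
  hence "coprime (int p) 2"
    using p(1) by (intro prime_imp_coprime) auto
  hence cop: "coprime (2 ^ (p - 1)) (int p ^ n)" for n
    by (simp add: coprime_commute)
  show ?thesis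
  proof (induction w)
    case 0
    let ?u = "lucas_u a l" and ?v = "lucas_v a l"
    have fermat: "[2 ^ (p - 1) * x = x] (mod int p)" for x :: int
      using cong_mult[OF fermat_theorem_int[OF p(1) two] cong_refl, of x] by simp
    have "[lucas_u a (p * l) = 2 ^ (p - 1) * lucas_u a (p * l)] (mod int p)"
      by (rule cong_sym[OF fermat])
    also have "[2 ^ (p - 1) * lucas_u a (p * l) = \<epsilon> * ?u] (mod int p)"
      unfolding FG F_def \<epsilon>_def by (rule lucas_sum_cong(1)[OF p])
    finally have 1: "[lucas_u a (p * l) = \<epsilon> * ?u] (mod int p)" .
    have "[lucas_v a (p * l) = 2 ^ (p - 1) * lucas_v a (p * l)] (mod int p)"
      by (rule cong_sym[OF fermat])
    also have "[2 ^ (p - 1) * lucas_v a (p * l) = ?v] (mod int p)"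
      unfolding FG G_def by (rule lucas_sum_cong(2)[OF p])
    finally show ?case using 1 by simp
  next
    case (Suc w)
    define j where "j = p ^ w * l"
    let ?u = "lucas_u a" and ?v = "lucas_v a"
    from Suc have IH: "[?u (p * j) = \<epsilon> * ?u j] (mod int p ^ Suc w)"
        "[?v (p * j) = ?v j] (mod int p ^ Suc w)"
      by (simp_all add: j_def)
    have D: "?D * ?u n ^ 2 = ?v n ^ 2 - 4" for n
      using lucas_norm[of a n] by simp
    \<comment> \<open>For \<epsilon> = 0, squaring the congruence for \<open>u\<close> does not
      yield this; the norm identity obtains it from \<open>v\<close>.\<close>
    have DIH: "[?D * ?u (p * j) ^ 2 = ?D * ?u j ^ 2] (mod int p ^ Suc w)"
      unfolding D by (intro cong_diff cong_pow IH cong_refl)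
    have eps: "\<epsilon> \<in> {-1, 0, 1}"
      unfolding \<epsilon>_def by (rule Legendre_cases)
    \<comment> \<open>Modulo higher powers \<open>2 ^ (p - 1)\<close> need not be 1, but it stands
      on both sides and is invertible.\<close>
    have "[2 ^ (p - 1) * ?u (p * (p * j)) = 2 ^ (p - 1) * (\<epsilon> * ?u (p * j))] (mod int p ^ Suc (Suc w))"
      using lucas_sum_lift(1)[OF p eps IH DIH] FG(1)[of "p * j"] FG(1)[of j]
      by (simp add: F_def mult.left_commute)
    hence 1: "[?u (p * (p * j)) = \<epsilon> * ?u (p * j)] (mod int p ^ Suc (Suc w))"
      using cop by (simp only: cong_mult_lcancel)
    have "[2 ^ (p - 1) * ?v (p * (p * j)) = 2 ^ (p - 1) * ?v (p * j)] (mod int p ^ Suc (Suc w))"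
      using lucas_sum_lift(2)[OF p eps IH DIH] FG(2)[of "p * j"] FG(2)[of j]
      by (simp add: G_def)
    hence "[?v (p * (p * j)) = ?v (p * j)] (mod int p ^ Suc (Suc w))"
      using cop by (simp only: cong_mult_lcancel)
    with 1 show ?case by (simp add: j_def mult_ac)
  qed
qed

section \<open>Powers of the trinomial modulo powers of \<open>p\<close>\<close>

definition trinomial :: "int \<Rightarrow> int fps" where
  "trinomial a = 1 - fps_const a * fps_X + fps_X ^ 2"

lemma trinomial_mult_lucas: "trinomial a * Abs_fps (\<lambda>n. lucas_u a (Suc n)) = 1"
proof (rule fps_ext)
  fix n
  show "(trinomial a * Abs_fps (\<lambda>n. lucas_u a (Suc n))) $ n = 1 $ n"
    by (induction a n rule: lucas_u.induct)
       (simp_all add: trinomial_def algebra_simps power2_eq_square fps_X_mult_nth)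
qed

lemma trinomial_power_nth_lucas:
  assumes "n > 0"
  shows "(trinomial a ^ (n - 1)) $ (n - 1) = (\<Sum>i<n. (trinomial a ^ n) $ i * lucas_u a (n - i))"
proof -
  have "trinomial a ^ (n - 1) = trinomial a ^ (n - 1) * (trinomial a * Abs_fps (\<lambda>n. lucas_u a (Suc n)))"
    by (simp add: trinomial_mult_lucas)
  also have "\<dots> = trinomial a ^ n * Abs_fps (\<lambda>n. lucas_u a (Suc n))"
    using assms by (simp add: mult.assoc[symmetric] power_Suc2[symmetric] del: power_Suc)
  finally have "(trinomial a ^ (n - 1)) $ (n - 1)
    = (\<Sum>i=0..n - 1. (trinomial a ^ n) $ i * lucas_u a (Suc (n - 1 - i)))"
    by (simp add: fps_mult_nth)
  also have "\<dots> = (\<Sum>i<n. (trinomial a ^ n) $ i * lucas_u a (n - i))"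
    using assms by (intro sum.cong) (auto simp: Suc_diff_le[symmetric])
  finally show ?thesis .
qed

lemma dvd_fps_power_nth_mult:
  fixes f :: "int fps"
  shows "int n dvd int i * (f ^ n) $ i"
proof (cases i)
  case (Suc k)
  have "int i * (f ^ n) $ i = fps_deriv (f ^ n) $ k"
    by (simp add: Suc)
  also have "\<dots> = int n * (fps_deriv f * f ^ (n - 1)) $ k"
    by (simp add: fps_deriv_power mult.assoc)
  finally show ?thesis by simp
qed simp

lemma fps_of_nat_power_dvd_nth:
  fixes f :: "int fps"
  assumes "of_nat p ^ k dvd f"
  shows "int p ^ k dvd f $ i"
proof -
  from assms obtain g where "f = of_nat p ^ k * g" by (elim dvdE)
  hence "f = fps_const (int p ^ k) * g" by (simp add: fps_of_nat[symmetric] fps_const_power)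
  thus ?thesis by simp
qed

text \<open>The additive rule for \<open>p\<close>-th powers is applied once for each plus sign in
  \<open>1 + (-a) X + X^2\<close>; Fermat then replaces \<open>(-a) ^ p\<close> by
  \<open>-a\<close>.\<close>

lemma prime_dvd_trinomial_power_diff:
  assumes "prime p"
  shows "of_nat p dvd trinomial a ^ p - (trinomial a oo fps_X ^ p)"
proof -
  let ?b = "fps_const a * fps_X :: int fps"
  have p: "p > 0" using assms prime_gt_0_nat by blast
  have comp: "trinomial a oo fps_X ^ p = 1 - fps_const a * fps_X ^ p + (fps_X ^ p) ^ 2"
    using p by (simp add: trinomial_def fps_compose_add_distrib fps_compose_sub_distrib
        fps_compose_mult_distrib fps_compose_power[symmetric])
  \<comment> \<open>Keeping the sign inside the constant avoids a factor
    \<open>(-1) ^ p\<close>.\<close>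
  have "trinomial a = (1 + fps_const (-a) * fps_X) + fps_X ^ 2"
    by (simp add: trinomial_def flip: fps_const_neg)
  hence 1: "of_nat p dvd trinomial a ^ p - ((1 + fps_const (-a) * fps_X) ^ p + (fps_X ^ 2) ^ p)"
    using prime_dvd_power_add_diff[OF assms] by metis
  have 2: "of_nat p dvd (1 + fps_const (-a) * fps_X :: int fps) ^ p - (1 ^ p + (fps_const (-a) * fps_X) ^ p)"
    by (rule prime_dvd_power_add_diff[OF assms])
  have "int p dvd (-a) ^ p - (-a)"
    using cong_power_prime_int[OF assms, of "-a"] by (simp add: cong_iff_dvd_diff)
  then obtain q where "(-a) ^ p - (-a) = int p * q" by (elim dvdE)
  hence "fps_const ((-a) ^ p) - fps_const (-a) = of_nat p * fps_const q"
    by (simp add: fps_of_nat[symmetric])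
  hence 3: "of_nat p dvd (fps_const ((-a) ^ p) - fps_const (-a)) * fps_X ^ p"
    by simp
  have "trinomial a ^ p - (trinomial a oo fps_X ^ p)
    = (trinomial a ^ p - ((1 + fps_const (-a) * fps_X) ^ p + (fps_X ^ 2) ^ p))
      + ((1 + fps_const (-a) * fps_X) ^ p - (1 ^ p + (fps_const (-a) * fps_X) ^ p))
      + (fps_const ((-a) ^ p) - fps_const (-a)) * fps_X ^ p"
  proof -
    \<comment> \<open>\<open>B\<close> stands for \<open>(1 + fps_const (-a) * fps_X) ^ p\<close>,
      \<open>C\<close> for \<open>fps_const ((-a) ^ p)\<close> and \<open>Y\<close> for
      \<open>fps_X ^ p\<close>; the right side telescopes.\<close>
    have expand: "t - (1 - A * Y + Z) = (t - (B + Z)) + (B - (1 + C * Y)) + (C - (-A)) * Y"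
      for t A B C Y Z :: "int fps"
      by (simp add: algebra_simps)
    have "fps_const (-a) = - fps_const a" by simp
    moreover have "(fps_X ^ 2) ^ p = ((fps_X ^ p) ^ 2 :: int fps)"
      by (simp only: power_mult[symmetric] mult.commute)
    ultimately show ?thesis
      unfolding comp power_mult_distrib fps_const_power power_one by (simp only: expand)
  qed
  thus ?thesis using 1 2 3 by (simp only: dvd_add)
qed

lemma trinomial_power_nth_cong:
  assumes "prime p" and "p ^ w dvd n"
  shows "[(trinomial a ^ (p * n)) $ i = (if p dvd i then (trinomial a ^ n) $ (i div p) else 0)]
    (mod int p ^ Suc w)"
proof -
  have p: "p > 0" using assms prime_gt_0_nat by blast
  have "of_nat p ^ Suc w dvd (trinomial a ^ p) ^ n - (trinomial a oo fps_X ^ p) ^ n"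
    by (intro dvd_power_mult_diff prime_dvd_trinomial_power_diff assms)
  also have "(trinomial a oo fps_X ^ p) ^ n = trinomial a ^ n oo fps_X ^ p"
    using p by (intro fps_compose_power) simp
  finally have "int p ^ Suc w dvd ((trinomial a ^ p) ^ n - (trinomial a ^ n oo fps_X ^ p)) $ i"
    by (rule fps_of_nat_power_dvd_nth)
  thus ?thesis
    using fps_nth_compose_X_power[of "trinomial a ^ n" p i]
    by (simp add: cong_iff_dvd_diff power_mult)
qed

lemma trinomial_power_cong:
  fixes a :: int
  assumes p: "prime p" "odd p" and n: "n > 0" and w: "p ^ w dvd n"
  shows "[(trinomial a ^ (p * n - 1)) $ (p * n - 1)
    = Legendre (a ^ 2 - 4) (int p) * (trinomial a ^ (n - 1)) $ (n - 1)] (mod int p ^ Suc w)"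
proof -
  let ?\<epsilon> = "Legendre (a ^ 2 - 4) (int p)"
  define c where "c i = (trinomial a ^ n) $ i" for i
  have p0: "p > 0" using p prime_gt_0_nat by blast
  have "(trinomial a ^ (p * n - 1)) $ (p * n - 1)
    = (\<Sum>i<p * n. (trinomial a ^ (p * n)) $ i * lucas_u a (p * n - i))"
    using p0 n by (intro trinomial_power_nth_lucas) simp
  also have "[\<dots> = (\<Sum>i<p * n. (if p dvd i then c (i div p) else 0) * lucas_u a (p * n - i))]
    (mod int p ^ Suc w)"
    unfolding c_def by (intro cong_sum cong_mult cong_refl trinomial_power_nth_cong p w)
  also have "(\<Sum>i<p * n. (if p dvd i then c (i div p) else 0) * lucas_u a (p * n - i))
    = (\<Sum>i | i < p * n \<and> p dvd i. c (i div p) * lucas_u a (p * n - i))"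
    by (intro sum.mono_neutral_cong_right) auto
  \<comment> \<open>Only multiples \<open>p * i\<close> remain as indices, which makes every Lucas
    index a multiple of \<open>p\<close>.\<close>
  also have "\<dots> = (\<Sum>i<n. c i * lucas_u a (p * (n - i)))"
    using p0 by (intro sum.reindex_bij_witness[of _ "\<lambda>i. p * i" "\<lambda>i. i div p"])
      (auto simp: right_diff_distrib' less_mult_imp_div_less mult.commute)
  also have "[\<dots> = (\<Sum>i<n. c i * (?\<epsilon> * lucas_u a (n - i)))] (mod int p ^ Suc w)"
  proof (rule cong_sum)
    fix i assume "i \<in> {..<n}"
    hence i: "i < n" by simp
    then obtain l where l: "n - i = p ^ multiplicity p (n - i) * l" "\<not> p dvd l"
      using p by (metis multiplicity_decompose' not_prime_unit zero_less_diff less_numeral_extra(3))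
    define t where "t = multiplicity p (n - i)"
    note l = l[folded t_def]
    \<comment> \<open>Thus \<open>p ^ w\<close> divides \<open>(n - i) * c i\<close>, and the
      cofactor \<open>l\<close>, being prime to \<open>p\<close>, can be removed.\<close>
    have "int n dvd int n * c i - int i * c i"
      unfolding c_def by (intro dvd_diff dvd_fps_power_nth_mult) simp
    also have "\<dots> = int (n - i) * c i" using i by (simp add: of_nat_diff algebra_simps)
    finally have "int p ^ w dvd int l * (int p ^ t * c i)"
      using w l(1) by (metis (no_types, lifting) dvd_trans int_dvd_int_iff mult.assoc mult.left_commute
          of_nat_mult of_nat_power)
    moreover have "coprime (int p ^ w) (int l)"
      using p(1) l(2) by (simp add: prime_imp_coprime)
    ultimately have "int p ^ w dvd int p ^ t * c i"
      by (simp add: coprime_dvd_mult_right_iff)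
    hence "int p ^ Suc w dvd int p ^ Suc t * c i" by (simp add: mult.assoc)
    \<comment> \<open>Here \<open>t\<close> may be smaller than \<open>w\<close>; the factor
      \<open>c i\<close> supplies the missing powers of \<open>p\<close>.\<close>
    moreover have "[lucas_u a (p * (n - i)) = ?\<epsilon> * lucas_u a (n - i)] (mod int p ^ Suc t)"
      using lucas_cong_prime_power[OF p, of a t l] l(1) by simp
    hence "int p ^ Suc t * c i dvd (lucas_u a (p * (n - i)) - ?\<epsilon> * lucas_u a (n - i)) * c i"
      by (simp only: cong_iff_dvd_diff mult_dvd_mono dvd_refl)
    ultimately show "[c i * lucas_u a (p * (n - i)) = c i * (?\<epsilon> * lucas_u a (n - i))] (mod int p ^ Suc w)"
      by (metis cong_iff_dvd_diff dvd_trans left_diff_distrib mult.commute)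
  qed
  also have "(\<Sum>i<n. c i * (?\<epsilon> * lucas_u a (n - i))) = ?\<epsilon> * (trinomial a ^ (n - 1)) $ (n - 1)"
    unfolding trinomial_power_nth_lucas[OF n] c_def by (simp add: sum_distrib_left mult.left_commute)
  finally show ?thesis .
qed

section \<open>Central trinomial coefficients as binomial sums\<close>

lemma fps_one_minus_X_power_nth:
  "((1 - fps_X :: int fps) ^ n) $ k = (-1) ^ k * int (n choose k)"
proof -
  have "(1 - fps_X :: int fps) ^ n = (\<Sum>i\<le>n. fps_const ((-1) ^ i * int (n choose i)) * fps_X ^ i)"
  proof -
    have "1 - fps_X = fps_const (-1) * fps_X + (1 :: int fps)" by simp
    thus ?thesis
      by (simp only: binomial_ring power_mult_distrib fps_const_power fps_of_nat[symmetric] power_one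
          mult_1_right fps_const_mult mult.assoc[symmetric] mult.commute[of "(-1) ^ _"])
  qed
  thus ?thesis
    by (simp add: fps_sum_nth if_distrib sum.delta cong: if_cong)
qed

text \<open>In the binomial expansion of \<open>((1 - X)^2 + m X)^n\<close> the factor
  \<open>X^(n - k)\<close> shifts the extraction to the middle coefficient of
  \<open>(1 - X)^(2 k)\<close>.\<close>

lemma trinomial_central_nth:
  "(trinomial (2 - m) ^ n) $ n
    = (\<Sum>k\<le>n. int (n choose k) * int ((2 * k) choose k) * (-1) ^ k * m ^ (n - k))"
proof -
  have tri: "trinomial (2 - m) = (1 - fps_X) ^ 2 + fps_const m * fps_X"
    by (simp add: trinomial_def power2_eq_square algebra_simps numeral_fps_const flip: fps_const_sub)
  have "(trinomial (2 - m) ^ n) $ n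
    = (\<Sum>k\<le>n. (fps_const (int (n choose k) * m ^ (n - k)) * (fps_X ^ (n - k) * (1 - fps_X) ^ (2 * k))) $ n)"
    unfolding tri binomial_ring fps_sum_nth
    by (intro sum.cong refl arg_cong[where f = "\<lambda>f. fps_nth f n"])
       (simp only: power_mult_distrib fps_const_power fps_of_nat[symmetric] power_mult[symmetric]
         mult_ac fps_const_mult[symmetric])
  also have "\<dots> = (\<Sum>k\<le>n. int (n choose k) * int ((2 * k) choose k) * (-1) ^ k * m ^ (n - k))"
    by (intro sum.cong refl) (simp add: fps_X_power_mult_nth fps_one_minus_X_power_nth mult_ac)
  finally show ?thesis .
qed

lemma trinomial_central_nth_rat:
  assumes "m \<noteq> 0"
  shows "(\<Sum>k = 0..n. of_nat (n choose k) * (of_nat ((2 * k) choose k) / (- of_int m) ^ k))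
    = (of_int ((trinomial (2 - m) ^ n) $ n) / of_int m ^ n :: rat)"
proof -
  have "of_int m ^ n * (of_nat (n choose k) * (of_nat ((2 * k) choose k) / (- of_int m) ^ k))
    = (of_int (int (n choose k) * int ((2 * k) choose k) * (-1) ^ k * m ^ (n - k)) :: rat)"
    if "k \<le> n" for k
  proof -
    have "(of_int m :: rat) ^ n = of_int m ^ (n - k) * of_int m ^ k"
      using that by (simp flip: power_add)
    moreover have "(- of_int m :: rat) ^ k = (-1) ^ k * of_int m ^ k"
      by (rule power_minus)
    \<comment> \<open>The sign is its own inverse, so it moves from the denominator to the
      numerator.\<close>
    moreover have "(-1 :: rat) ^ k * (-1) ^ k = 1"
      by (simp flip: power_mult_distrib)
    ultimately show ?thesis using assms by (simp add: field_simps)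
  qed
  hence "of_int m ^ n * (\<Sum>k = 0..n. of_nat (n choose k) * (of_nat ((2 * k) choose k) / (- of_int m) ^ k))
    = (of_int ((trinomial (2 - m) ^ n) $ n) :: rat)"
    unfolding trinomial_central_nth sum_distrib_left of_int_sum atMost_atLeast0
    by (intro sum.cong) auto
  thus ?thesis using assms by (simp add: field_simps)
qed

section \<open>Integrality at \<open>p\<close> and the final congruence\<close>

text \<open>The valuation is read off the reduced fraction, whose denominator divides
  \<open>b\<close> and is therefore prime to \<open>p\<close>.\<close>

lemma of_int_divide_in_rat_padic_ints:
  assumes p: "prime p" and b: "\<not> int p dvd b"
  shows "of_int x / of_int b \<in> rat_padic_ints p"
proof -
  let ?r = "of_int x / of_int b :: rat"
  obtain y d where q: "quotient_of ?r = (y, d)" by (cases "quotient_of ?r")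
  have b0: "b \<noteq> 0" using b by auto
  have d0: "d > 0" using quotient_of_denom_pos[OF q] .
  have "?r = of_int y / of_int d" using quotient_of_div[OF q] .
  hence "(of_int (x * d) :: rat) = of_int (y * b)" using b0 d0 by (simp add: field_simps)
  hence "x * d = y * b" by (simp only: of_int_eq_iff)
  hence "d dvd y * b" by (metis dvd_triv_right)
  hence "d dvd b" using quotient_of_coprime[OF q]
    by (simp add: coprime_commute coprime_dvd_mult_right_iff)
  hence "\<not> int p dvd d" using b dvd_trans by blast
  hence "padic_val p ?r \<ge> 0"
    by (simp add: padic_val_def q not_dvd_imp_multiplicity_0)
  moreover have "of_nat p \<ge> (1 :: rat)" using prime_gt_0_nat[OF p] by simp
  ultimately show ?thesis
    by (auto simp: rat_padic_ints_def padic_norm_def power_int_minus inverse_le_1_iff one_le_power_int)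
qed

theorem theorem1p2:
  fixes p n :: nat and m \<Delta> :: int
  assumes "prime p" and "odd p"
    and "\<not> [m = 0] (mod int p)"
    and "\<Delta> = m * (m - 4)"
    and "n > 0"
  shows "1 / (of_nat p * of_nat n) *
      ((\<Sum>k = 0..p * n - 1.
          of_nat ((p * n - 1) choose k) * (of_nat ((2 * k) choose k) / (- of_int m) ^ k))
       - of_int (Legendre \<Delta> (int p)) *
         (\<Sum>k = 0..n - 1.
            of_nat ((n - 1) choose k) * (of_nat ((2 * k) choose k) / (- of_int m) ^ k)))
    \<in> rat_padic_ints p"
proof -
  define T where "T k = (trinomial (2 - m) ^ k) $ k" for k
  define w where "w = multiplicity p n"
  obtain l where l: "n = p ^ w * l" "\<not> p dvd l"
    using assms(1,5) unfolding w_def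
    by (metis multiplicity_decompose' not_prime_unit less_numeral_extra(3))
  let ?\<epsilon> = "Legendre \<Delta> (int p)"
  have m: "\<not> int p dvd m" using assms(3) by (simp add: cong_0_iff)
  hence m0: "m \<noteq> 0" by auto
  have p0: "p > 0" using assms(1) prime_gt_0_nat by blast
  have disc: "(2 - m) ^ 2 - 4 = \<Delta>"
    using assms(4) by (simp add: power2_eq_square algebra_simps)
  \<comment> \<open>Bringing the second sum to the denominator \<open>m ^ (p * n - 1)\<close>
    multiplies its numerator by \<open>m ^ ((p - 1) * n)\<close>. Fermat, lifted to the exponent
    \<open>n\<close>, makes this factor 1 modulo \<open>p ^ Suc w\<close>.\<close>
  have "int p dvd m ^ (p - 1) - 1"
    using fermat_theorem_int[OF assms(1) m] by (simp add: cong_iff_dvd_diff)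
  from dvd_power_mult_diff[OF this, of w n]
  have "[m ^ ((p - 1) * n) = 1] (mod int p ^ Suc w)"
    by (simp add: l(1) cong_iff_dvd_diff power_mult)
  hence "[T (p * n - 1) - ?\<epsilon> * (m ^ ((p - 1) * n) * T (n - 1)) = ?\<epsilon> * T (n - 1) - ?\<epsilon> * (1 * T (n - 1))]
    (mod int p ^ Suc w)"
    using trinomial_power_cong[OF assms(1,2,5), of w "2 - m"] unfolding disc T_def
    by (intro cong_diff cong_mult cong_refl) (simp_all add: l(1))
  hence "int p ^ Suc w dvd T (p * n - 1) - ?\<epsilon> * (m ^ ((p - 1) * n) * T (n - 1))"
    by (simp add: cong_0_iff)
  then obtain z where z: "T (p * n - 1) - ?\<epsilon> * (m ^ ((p - 1) * n) * T (n - 1)) = int p ^ Suc w * z"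
    by (elim dvdE)
  have "p * n - 1 = (p - 1) * n + (n - 1)"
    using assms(5) p0 by (simp add: diff_mult_distrib)
  hence pow: "(of_int m :: rat) ^ (p * n - 1) = of_int m ^ ((p - 1) * n) * of_int m ^ (n - 1)"
    by (simp add: power_add)
  have "of_int (T (p * n - 1)) / of_int m ^ (p * n - 1) - of_int ?\<epsilon> * (of_int (T (n - 1)) / of_int m ^ (n - 1))
    = (of_int (T (p * n - 1) - ?\<epsilon> * (m ^ ((p - 1) * n) * T (n - 1))) / of_int m ^ (p * n - 1) :: rat)"
    unfolding pow using m0 by (simp add: field_simps)
  also have "\<dots> = of_nat p * of_nat (p ^ w) * of_int z / of_int m ^ (p * n - 1)"
    unfolding z by simp
  \<comment> \<open>As \<open>p * n = p ^ Suc w * l\<close>, the powers of \<open>p\<close> cancel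
    exactly, leaving only \<open>l\<close> and a power of \<open>m\<close> in the
    denominator.\<close>
  finally have "1 / (of_nat p * of_nat n) *
      (of_int (T (p * n - 1)) / of_int m ^ (p * n - 1) - of_int ?\<epsilon> * (of_int (T (n - 1)) / of_int m ^ (n - 1)))
    = (of_int z / of_int (int l * m ^ (p * n - 1)) :: rat)"
    using p0 by (simp add: l(1))
  moreover have "\<not> int p dvd int l * m ^ (p * n - 1)"
  proof
    assume "int p dvd int l * m ^ (p * n - 1)"
    hence "int p dvd int l \<or> int p dvd m"
      using assms(1) by (metis prime_dvd_mult_iff prime_dvd_power prime_nat_int_transfer)
    thus False using l(2) m by simp
  qed
  hence "of_int z / of_int (int l * m ^ (p * n - 1)) \<in> rat_padic_ints p"
    by (rule of_int_divide_in_rat_padic_ints[OF assms(1)])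
  ultimately show ?thesis
    unfolding trinomial_central_nth_rat[OF m0] T_def[symmetric] by (simp only:)
qed

end
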